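(* Let $0<\alpha<1$ and let $(\epsilon_i)_{i\ge 1}$ be a nonincreasing sequence of positive real numbers with $\epsilon_1\le 1-\alpha$ and $\sum_{i=1}^{+\infty}2^{i-1}\epsilon_i<\alpha$. Let $\psi:[0,1)\to\mathbb{R}$ be the pointwise limit $\psi(x)=\lim_{i\to\infty}\psi_i(x)$ of the sequence of functions $\psi_i$ constructed from $\alpha,\epsilon_1,\epsilon_2,\ldots$ as described in the context. Then $\psi$ is not piecewise linear.
   Context: A function $\pi:[0,1)\to\mathbb{R}$ is piecewise linear if there are finitely many values $0=r_0<r_1<\cdots<r_k=1$ and reals $a_j,b_j$ such that $\pi(r)=a_jr+b_j$ for all $r\in[r_{j-1},r_j)$, $j=1,\ldots,k$. Construction of $\psi_i$: let $0<\alpha<1$ and let $(\epsilon_i)_{i\ge1}$ be a nonincreasing sequence of positive reals with $\epsilon_1\le 1-\alpha$ and $\sum_{i\ge1}2^{i-1}\epsilon_i<\alpha$. Define $\psi_0(x)=x/\alpha$ for $0\le x\le\alpha$ and $\psi_0(x)=(1-x)/(1-\alpha)$ for $\alpha\le x<1$. Given $\psi_i$, the function $\psi_{i+1}:[0,1)\to\mathbb{R}$ is obtained by modifying $\psi_i$ as follows: for every maximal (with respect to inclusion) interval $[a,b]\subseteq[0,\alpha]$ on which $\psi_i$ has constant positive slope, the line segment of the graph from $(a,\psi_i(a))$ to $(b,\psi_i(b))$ is replaced by the three segments successively connecting the points $(a,\psi_i(a))$, $\left(\frac{a+b-\epsilon_{i+1}}{2},\psi_i(\frac{a+b}{2})+\frac{\epsilon_{i+1}}{2(1-\alpha)}\right)$,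 $\left(\frac{a+b+\epsilon_{i+1}}{2},\psi_i(\frac{a+b}{2})-\frac{\epsilon_{i+1}}{2(1-\alpha)}\right)$, $(b,\psi_i(b))$; elsewhere $\psi_{i+1}=\psi_i$. The pointwise limit $\psi(x)=\lim_{i\to\infty}\psi_i(x)$ exists for every $x\in[0,1)$. *)

theory Defs
  imports Complex_Main
begin

text \<open>Functions on [0,1) are represented by total functions on the reals; their values outside
  [0,1) play no role.\<close>

definition piecewise_linear :: "(real \<Rightarrow> real) \<Rightarrow> bool" where
  "piecewise_linear \<pi> \<longleftrightarrow>
     (\<exists>(k::nat) (r::nat \<Rightarrow> real) (a::nat \<Rightarrow> real) (b::nat \<Rightarrow> real).
        r 0 = 0 \<and> r k = 1 \<and> (\<forall>j\<in>{1..k}. r (j - 1) < r j) \<and>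
        (\<forall>j\<in>{1..k}. \<forall>x\<in>{r (j - 1)..<r j}. \<pi> x = a j * x + b j))"

definition const_pos_slope :: "(real \<Rightarrow> real) \<Rightarrow> real \<Rightarrow> real \<Rightarrow> bool" where
  "const_pos_slope f a b \<longleftrightarrow>
     a < b \<and> (\<exists>s>0. \<forall>x\<in>{a..b}. \<forall>y\<in>{a..b}. f y - f x = s * (y - x))"

definition max_pos_interval :: "real \<Rightarrow> (real \<Rightarrow> real) \<Rightarrow> real \<Rightarrow> real \<Rightarrow> bool" where
  "max_pos_interval \<alpha> f a b \<longleftrightarrow>
     {a..b} \<subseteq> {0..\<alpha>} \<and> const_pos_slope f a b \<and>
     (\<forall>c d. {c..d} \<subseteq> {0..\<alpha>} \<and> const_pos_slope f c d \<and> {a..b} \<subseteq> {c..d}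
        \<longrightarrow> {c..d} = {a..b})"

definition line_through :: "real \<times> real \<Rightarrow> real \<times> real \<Rightarrow> real \<Rightarrow> real" where
  "line_through p q x = snd p + (snd q - snd p) / (fst q - fst p) * (x - fst p)"

definition three_segments :: "real \<Rightarrow> real \<Rightarrow> (real \<Rightarrow> real) \<Rightarrow> real \<Rightarrow> real \<Rightarrow> real \<Rightarrow> real" where
  "three_segments \<alpha> e f a b x =
     (let P = (a, f a);
          Q = ((a + b - e) / 2, f ((a + b) / 2) + e / (2 * (1 - \<alpha>)));
          R = ((a + b + e) / 2, f ((a + b) / 2) - e / (2 * (1 - \<alpha>)));
          S = (b, f b)
      in if x \<le> fst Q then line_through P Q x
         else if x \<le> fst R then line_through Q R x
         else line_through R S x)"

text \<open>Two distinct maximal intervals of constant positive slope of a stage of the construction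
  are separated by an interval of negative slope, hence disjoint, so that the definite
  description below picks the unique one containing x.\<close>

definition refine :: "real \<Rightarrow> real \<Rightarrow> (real \<Rightarrow> real) \<Rightarrow> real \<Rightarrow> real" where
  "refine \<alpha> e f x =
     (if \<exists>a b. max_pos_interval \<alpha> f a b \<and> x \<in> {a..b}
      then (let (a, b) = (THE (a, b). max_pos_interval \<alpha> f a b \<and> x \<in> {a..b})
            in three_segments \<alpha> e f a b x)
      else f x)"

text \<open>The sequence \<open>\<epsilon>\<close> is indexed from 1; its value at 0 is never used.\<close>

primrec psi_seq :: "real \<Rightarrow> (nat \<Rightarrow> real) \<Rightarrow> nat \<Rightarrow> real \<Rightarrow> real" where
  "psi_seq \<alpha> \<epsilon> 0 = (\<lambda>x. if x \<le> \<alpha> then x / \<alpha> else (1 - x) / (1 - \<alpha>))"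
| "psi_seq \<alpha> \<epsilon> (Suc i) = refine \<alpha> (\<epsilon> (Suc i)) (psi_seq \<alpha> \<epsilon> i)"

end

theory Submission
  imports Defs
begin

text \<open>Only the leftmost maximal interval \<open>[0, L\<^sub>i]\<close> of positive slope matters. On it \<open>\<psi>\<^sub>i\<close> is linear
  with value 0 at 0, and immediately to its right \<open>\<psi>\<^sub>i\<close> starts at a positive value with slope
  \<open>-1/(1 - \<alpha>)\<close>; no later refinement touches a piece of negative slope. Since \<open>L\<^sub>i \<longrightarrow> 0\<close>, the limit
  has, arbitrarily close to 0, positive values and negative slope, whereas \<open>\<psi>(0) = 0\<close>. A function
  that is affine to the right of 0 and vanishes at 0 cannot do this.\<close>

definition initial_tooth :: "real \<Rightarrow> (real \<Rightarrow> real) \<Rightarrow> real \<Rightarrow> real \<Rightarrow> real \<Rightarrow> bool" where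
  "initial_tooth c f s L \<delta> \<longleftrightarrow> 0 < s \<and> 0 < L \<and> 0 < \<delta> \<and>
     (\<forall>x\<in>{0..L}. f x = s * x) \<and> (\<forall>x\<in>{L..L + \<delta>}. f x = s * L - c * (x - L))"

lemma const_pos_slope_less:
  assumes "const_pos_slope f a b" "x \<in> {a..b}" "y \<in> {a..b}" "x < y"
  shows "f x < f y"
proof -
  obtain s where "s > 0" "f y - f x = s * (y - x)"
    using assms unfolding const_pos_slope_def by blast
  moreover have "s * (y - x) > 0" using \<open>s > 0\<close> assms(4) by simp
  ultimately show ?thesis by simp
qed

text \<open>Since \<open>a < b\<close>, the intervals \<open>(a, b)\<close> and
  \<open>(u, v)\<close> share a nonempty open interval; two of its points would have to be ordered
  both ways by \<open>f\<close>.\<close>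

lemma not_const_pos_slope_if_decreasing:
  assumes dec: "\<And>x y. u < x \<Longrightarrow> x < y \<Longrightarrow> y < v \<Longrightarrow> f y < f x"
    and "u < v" "a < v" "u < b"
  shows "\<not> const_pos_slope f a b"
proof
  assume h: "const_pos_slope f a b"
  define p where "p = max a u"
  define q where "q = min b v"
  have "a < b" using h by (simp add: const_pos_slope_def)
  hence "p < q" using assms by (auto simp: p_def q_def)
  then obtain x where x: "p < x" "x < q" using dense by blast
  obtain y where y: "x < y" "y < q" using x(2) dense by blast
  have "f x < f y"
    using const_pos_slope_less[OF h, of x y] x y by (auto simp: p_def q_def)
  moreover have "f y < f x"
    using dec[of x y] x y by (auto simp: p_def q_def)
  ultimately show False by simp
qed

text \<open>Any maximal interval containing \<open>x\<close> would overlap \<open>(u, v)\<close>,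
  where no positive slope is possible, so \<open>refine\<close> falls into its \<open>else\<close>
  branch. This is what protects descents from later stages.\<close>

lemma refine_decreasing:
  assumes "\<And>x y. u < x \<Longrightarrow> x < y \<Longrightarrow> y < v \<Longrightarrow> f y < f x" "u < x" "x < v"
  shows "refine \<alpha> e f x = f x"
proof -
  have "\<not> (max_pos_interval \<alpha> f a b \<and> x \<in> {a..b})" for a b
    using not_const_pos_slope_if_decreasing[of u v f a b] assms
    by (auto simp: max_pos_interval_def)
  thus ?thesis unfolding refine_def by auto
qed

lemma initial_tooth_decreasing:
  assumes "initial_tooth c f s L \<delta>" "0 < c" "L < x" "x < y" "y < L + \<delta>"
  shows "f y < f x"
  using assms by (auto simp: initial_tooth_def)

text \<open>An interval of positive slope starting at or before \<open>L\<close> cannot run into the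
  descent after \<open>L\<close>, so inside \<open>[0, \<alpha>]\<close> it is contained in
  \<open>[0, L]\<close>, which has slope \<open>s\<close> itself. The equivalence yields both the
  existence and the uniqueness that \<open>THE\<close> in \<open>refine\<close> requires.\<close>

lemma max_pos_interval_initial_tooth:
  assumes t: "initial_tooth c f s L \<delta>" and "0 < c" "L \<le> \<alpha>" "x \<in> {0..L}"
  shows "max_pos_interval \<alpha> f a b \<and> x \<in> {a..b} \<longleftrightarrow> a = 0 \<and> b = L"
proof -
  have L: "0 < L" "0 < \<delta>" "0 < s" and f: "\<forall>x\<in>{0..L}. f x = s * x"
    using t by (auto simp: initial_tooth_def)
  have ends: "d \<le> L" if "const_pos_slope f c' d" "c' \<le> L" for c' d
    using not_const_pos_slope_if_decreasing[of L "L + \<delta>" f c' d]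
      initial_tooth_decreasing[OF t \<open>0 < c\<close>] that L by force
  have pos: "const_pos_slope f 0 L"
    unfolding const_pos_slope_def
  proof (intro conjI exI[of _ s] ballI)
    fix x y assume "x \<in> {0..L}" "y \<in> {0..L}"
    thus "f y - f x = s * (y - x)" using f by (simp add: algebra_simps)
  qed (use L in auto)
  have max: "max_pos_interval \<alpha> f 0 L"
    unfolding max_pos_interval_def
  proof (intro conjI allI impI)
    fix c' d assume h: "{c'..d} \<subseteq> {0..\<alpha>} \<and> const_pos_slope f c' d \<and> {0..L} \<subseteq> {c'..d}"
    hence "c' \<le> 0" "L \<le> d" "c' < d" using L by (auto simp: const_pos_slope_def)
    moreover have "0 \<le> c'" using h \<open>c' < d\<close> by auto
    moreover have "d \<le> L" using ends[of c' d] h \<open>c' \<le> 0\<close> L by auto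
    ultimately show "{c'..d} = {0..L}" by auto
  qed (use assms L pos in auto)
  have "a = 0 \<and> b = L" if h: "max_pos_interval \<alpha> f a b" "x \<in> {a..b}"
  proof -
    have ab: "const_pos_slope f a b" "{a..b} \<subseteq> {0..\<alpha>}" "a < b"
      using h(1) by (auto simp: max_pos_interval_def const_pos_slope_def)
    have "0 \<le> a" using ab by auto
    moreover have "b \<le> L" using ends[OF ab(1)] h(2) assms(4) by auto
    ultimately have "{a..b} \<subseteq> {0..L}" by auto
    moreover have "{0..L} \<subseteq> {0..\<alpha>}" using assms(3) by auto
    ultimately have "{0..L} = {a..b}"
      using h(1) pos unfolding max_pos_interval_def by blast
    thus ?thesis using L by (auto simp: Icc_eq_Icc)
  qed
  thus ?thesis using max assms(4) by auto
qed

lemma refine_initial_tooth: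
  assumes "initial_tooth c f s L \<delta>" "0 < c" "L \<le> \<alpha>" "x \<in> {0..L}"
  shows "refine \<alpha> e f x = three_segments \<alpha> e f 0 L x"
proof -
  note iff = max_pos_interval_initial_tooth[OF assms]
  have "(THE (a, b). max_pos_interval \<alpha> f a b \<and> x \<in> {a..b}) = (0, L)"
    unfolding iff by (rule the_equality) auto
  moreover have "\<exists>a b. max_pos_interval \<alpha> f a b \<and> x \<in> {a..b}"
    using iff by blast
  ultimately show ?thesis unfolding refine_def by simp
qed

text \<open>The new apex is the point \<open>Q\<close> of \<open>three_segments\<close> for
  \<open>[0, L]\<close>. The middle segment has width \<open>e\<close> and drop
  \<open>e / (1 - \<alpha>)\<close>, so the slope of the descent is the same at every stage. The
  condition \<open>e < L\<close> puts \<open>Q\<close> to the right of 0.\<close>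

lemma initial_tooth_refine:
  assumes t: "initial_tooth (1 / (1 - \<alpha>)) f s L \<delta>" and "\<alpha> < 1" "L \<le> \<alpha>" "0 < e" "e < L"
  shows "\<exists>s'. initial_tooth (1 / (1 - \<alpha>)) (refine \<alpha> e f) s' ((L - e) / 2) e"
proof -
  define c where "c = 1 / (1 - \<alpha>)"
  have c: "0 < c" using assms by (simp add: c_def)
  have f: "f x = s * x" if "x \<in> {0..L}" for x
    using t that by (auto simp: initial_tooth_def)
  have f0: "f 0 = 0" "f (L / 2) = s * L / 2" using f[of 0] f[of "L / 2"] assms by auto
  have e: "e / (2 * (1 - \<alpha>)) = c * e / 2" by (simp add: c_def)
  have s: "0 < s" using t by (simp add: initial_tooth_def)
  \<comment> \<open>Slope of the segment from the origin to \<open>Q\<close>, whose height is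
    \<open>s * L / 2 + c * e / 2\<close>.\<close>
  define s' where "s' = (s * L + c * e) / (L - e)"
  have "s * L + c * e > 0" using s c assms by (intro add_pos_pos mult_pos_pos) auto
  hence s': "0 < s'" using assms by (simp add: s'_def)
  have val: "s' * ((L - e) / 2) = s * L / 2 + c * e / 2"
    using assms by (simp add: s'_def field_simps)
  have left: "refine \<alpha> e f x = s' * x" if "x \<in> {0..(L - e) / 2}" for x
  proof -
    have "refine \<alpha> e f x = three_segments \<alpha> e f 0 L x"
      using refine_initial_tooth[OF t] c assms that by (auto simp: c_def)
    also have "\<dots> = (s * L / 2 + c * e / 2) / ((L - e) / 2) * x"
      using that unfolding three_segments_def Let_def line_through_def e
      by (simp add: f0)
    also have "(s * L / 2 + c * e / 2) / ((L - e) / 2) = s'"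
      using assms by (simp add: s'_def field_simps)
    finally show ?thesis .
  qed
  have right: "refine \<alpha> e f x = s' * ((L - e) / 2) - c * (x - (L - e) / 2)"
    if "x \<in> {(L - e) / 2..(L - e) / 2 + e}" for x
  proof (cases "x = (L - e) / 2")
    \<comment> \<open>At the apex \<open>three_segments\<close> still takes its first branch, so the
      value comes from \<open>left\<close>.\<close>
    case True
    have "refine \<alpha> e f x = s' * ((L - e) / 2)"
      unfolding True by (rule left) (use assms in simp)
    thus ?thesis unfolding True by simp
  next
    case False
    have x: "(L - e) / 2 < x" "x \<le> (L + e) / 2" using that False by (auto simp: field_simps)
    have "refine \<alpha> e f x = three_segments \<alpha> e f 0 L x"
      using refine_initial_tooth[OF t] c assms x by (auto simp: c_def)
    also have "\<dots> = (s * L / 2 + c * e / 2)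
        + (- (c * e)) / ((L + e) / 2 - (L - e) / 2) * (x - (L - e) / 2)"
      using x unfolding three_segments_def Let_def line_through_def e
      by (simp add: f0)
    also have "(L + e) / 2 - (L - e) / 2 = e" by (simp add: field_simps)
    finally show ?thesis using val assms by simp
  qed
  show ?thesis
    unfolding initial_tooth_def c_def[symmetric]
    using left right s' assms by (intro exI[of _ s']) auto
qed

text \<open>Closed form of the apex recursion: start at \<alpha>, then subtract the next
  \<open>\<epsilon>\<close> and halve.\<close>

definition tooth_pos :: "real \<Rightarrow> (nat \<Rightarrow> real) \<Rightarrow> nat \<Rightarrow> real" where
  "tooth_pos \<alpha> \<epsilon> i = (\<alpha> - (\<Sum>j<i. 2 ^ j * \<epsilon> (Suc j))) / 2 ^ i"

lemma tooth_pos_Suc: "tooth_pos \<alpha> \<epsilon> (Suc i) = (tooth_pos \<alpha> \<epsilon> i - \<epsilon> (Suc i)) / 2"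
  by (simp add: tooth_pos_def field_simps)

lemma tooth_pos_le:
  assumes "\<And>i. i \<ge> 1 \<Longrightarrow> \<epsilon> i > 0"
  shows "tooth_pos \<alpha> \<epsilon> i \<le> \<alpha> / 2 ^ i"
proof -
  have "0 \<le> (\<Sum>j<i. 2 ^ j * \<epsilon> (Suc j))"
    using assms by (intro sum_nonneg) (simp add: less_imp_le)
  thus ?thesis by (simp add: tooth_pos_def divide_right_mono)
qed

text \<open>Even with the term of index \<open>i\<close> included, the partial sum stays below
  \<alpha>; dividing by \<open>2 ^ i\<close> gives the claim. It guarantees that the next middle
  segment fits into the initial ascent.\<close>

lemma tooth_pos_gt:
  assumes "\<And>i. i \<ge> 1 \<Longrightarrow> \<epsilon> i > 0"
    and "summable (\<lambda>i. 2 ^ i * \<epsilon> (Suc i))" "(\<Sum>i. 2 ^ i * \<epsilon> (Suc i)) < \<alpha>"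
  shows "\<epsilon> (Suc i) < tooth_pos \<alpha> \<epsilon> i"
proof -
  have "(\<Sum>j<Suc i. 2 ^ j * \<epsilon> (Suc j)) \<le> (\<Sum>i. 2 ^ i * \<epsilon> (Suc i))"
    using assms by (intro sum_le_suminf) (auto simp: less_imp_le)
  hence "2 ^ i * \<epsilon> (Suc i) < \<alpha> - (\<Sum>j<i. 2 ^ j * \<epsilon> (Suc j))"
    using assms(3) by simp
  thus ?thesis by (simp add: tooth_pos_def field_simps)
qed

lemma initial_tooth_psi_seq:
  assumes "0 < \<alpha>" "\<alpha> < 1" and pos: "\<And>i. i \<ge> 1 \<Longrightarrow> \<epsilon> i > 0"
    and "summable (\<lambda>i. 2 ^ i * \<epsilon> (Suc i))" "(\<Sum>i. 2 ^ i * \<epsilon> (Suc i)) < \<alpha>"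
  shows "\<exists>s \<delta>. initial_tooth (1 / (1 - \<alpha>)) (psi_seq \<alpha> \<epsilon> i) s (tooth_pos \<alpha> \<epsilon> i) \<delta>"
proof (induction i)
  case 0
  have "(1 - x) / (1 - \<alpha>) = 1 - (x - \<alpha>) / (1 - \<alpha>)" for x
    using assms by (simp add: field_simps)
  \<comment> \<open>The first ascent has slope \<open>1 / \<alpha>\<close>, and the descent from the
    peak at \<alpha> has length \<open>1 - \<alpha>\<close>, reaching 1.\<close>
  thus ?case using assms(1,2)
    by (intro exI[of _ "1 / \<alpha>"] exI[of _ "1 - \<alpha>"])
      (auto simp: initial_tooth_def tooth_pos_def)
next
  case (Suc i)
  then obtain s \<delta> where t: "initial_tooth (1 / (1 - \<alpha>)) (psi_seq \<alpha> \<epsilon> i) s (tooth_pos \<alpha> \<epsilon> i) \<delta>"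
    by blast
  have "\<alpha> / 2 ^ i \<le> \<alpha>" using assms(1) by (simp add: divide_le_eq)
  hence "tooth_pos \<alpha> \<epsilon> i \<le> \<alpha>" using tooth_pos_le[of \<epsilon> \<alpha> i, OF pos] by linarith
  thus ?case
    using initial_tooth_refine[OF t assms(2), of "\<epsilon> (Suc i)"] pos
      tooth_pos_gt[of \<epsilon> \<alpha> i, OF pos assms(4,5)]
    by (auto simp: tooth_pos_Suc)
qed

text \<open>Agreement with stage \<open>i\<close> on all of \<open>(L, L + \<delta>)\<close> makes
  stage \<open>j\<close> strictly decreasing there, so the next refinement changes nothing. The
  induction therefore has to generalize over \<open>x\<close>.\<close>

lemma psi_seq_stable:
  assumes t: "initial_tooth c (psi_seq \<alpha> \<epsilon> i) s L \<delta>" "0 < c" and "i \<le> j"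
    and "L < x" "x < L + \<delta>"
  shows "psi_seq \<alpha> \<epsilon> j x = psi_seq \<alpha> \<epsilon> i x"
  using assms(3-5)
proof (induction j arbitrary: x rule: dec_induct)
  case base
  show ?case ..
next
  case (step j)
  have "psi_seq \<alpha> \<epsilon> j z < psi_seq \<alpha> \<epsilon> j y" if "L < y" "y < z" "z < L + \<delta>" for y z
    using initial_tooth_decreasing[OF t that] step.IH[of y] step.IH[of z] that by simp
  thus ?case using refine_decreasing[of L "L + \<delta>" "psi_seq \<alpha> \<epsilon> j"] step by simp
qed

theorem fact5p5:
  fixes \<alpha> :: real and \<epsilon> :: "nat \<Rightarrow> real" and \<psi> :: "real \<Rightarrow> real"
  assumes "0 < \<alpha>" and "\<alpha> < 1"
    and "\<And>i. i \<ge> 1 \<Longrightarrow> \<epsilon> i > 0"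
    and "\<And>i j. 1 \<le> i \<Longrightarrow> i \<le> j \<Longrightarrow> \<epsilon> j \<le> \<epsilon> i"
    and "\<epsilon> 1 \<le> 1 - \<alpha>"
    and "summable (\<lambda>i. 2 ^ i * \<epsilon> (Suc i))"
    and "(\<Sum>i. 2 ^ i * \<epsilon> (Suc i)) < \<alpha>"
    and "\<And>x. x \<in> {0..<1} \<Longrightarrow> (\<lambda>i. psi_seq \<alpha> \<epsilon> i x) \<longlonglongrightarrow> \<psi> x"
  shows "\<not> piecewise_linear \<psi>"
proof
  assume "piecewise_linear \<psi>"
  then obtain k :: nat and r a b where r: "r 0 = 0" "r k = 1"
    "\<forall>j\<in>{1..k}. r (j - 1) < r j"
    "\<forall>j\<in>{1..k}. \<forall>x\<in>{r (j - 1)..<r j}. \<psi> x = a j * x + b j"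
    unfolding piecewise_linear_def by blast
  have "k \<noteq> 0" using r(1,2) by (cases k) auto
  hence "1 \<in> {1..k}" by auto
  hence r1: "0 < r 1" and lin: "\<And>x. 0 \<le> x \<Longrightarrow> x < r 1 \<Longrightarrow> \<psi> x = a 1 * x + b 1"
    using r by force+
  define c where "c = 1 / (1 - \<alpha>)"
  have c: "0 < c" using assms(2) by (simp add: c_def)
  note tooth = initial_tooth_psi_seq[OF assms(1-3,6,7), folded c_def]
  have "psi_seq \<alpha> \<epsilon> i 0 = 0" for i
    using tooth[of i] by (auto simp: initial_tooth_def)
  hence "\<psi> 0 = 0" using assms(8)[of 0] by (simp add: LIMSEQ_const_iff)
  hence b1: "b 1 = 0" using lin[of 0] r1 by simp
  \<comment> \<open>The apex of stage \<open>i\<close> is at most \<open>\<alpha> / 2 ^ i\<close>,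
    so a late stage has its apex inside the first affine piece of \<open>\<psi>\<close>.\<close>
  have "(\<lambda>i. \<alpha> / 2 ^ i) \<longlonglongrightarrow> 0" by (rule LIMSEQ_divide_realpow_zero) simp
  hence "\<forall>\<^sub>F i in sequentially. \<alpha> / 2 ^ i < min (r 1) 1"
    by (rule order_tendstoD) (use r1 in simp)
  then obtain i where i: "\<alpha> / 2 ^ i < min (r 1) 1"
    by (auto simp: eventually_sequentially)
  define L where "L = tooth_pos \<alpha> \<epsilon> i"
  have L1: "L < min (r 1) 1"
    unfolding L_def by (rule le_less_trans[OF tooth_pos_le[of \<epsilon> \<alpha> i, OF assms(3)] i])
  obtain s \<delta> where t: "initial_tooth c (psi_seq \<alpha> \<epsilon> i) s L \<delta>"
    using tooth[of i] by (auto simp: L_def)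
  hence L0: "0 < L" "0 < \<delta>" "0 < s" by (auto simp: initial_tooth_def)
  have psi: "\<psi> x = s * L - c * (x - L)" if x: "L < x" "x < L + \<delta>" "x < 1" for x
  proof -
    have "\<forall>\<^sub>F j in sequentially. psi_seq \<alpha> \<epsilon> j x = psi_seq \<alpha> \<epsilon> i x"
      using eventually_ge_at_top[of i]
      by eventually_elim (rule psi_seq_stable[OF t c _ x(1,2)])
    hence "(\<lambda>j. psi_seq \<alpha> \<epsilon> j x) \<longlonglongrightarrow> psi_seq \<alpha> \<epsilon> i x"
      by (rule tendsto_eventually)
    moreover have "(\<lambda>j. psi_seq \<alpha> \<epsilon> j x) \<longlonglongrightarrow> \<psi> x"
      using assms(8) x L0 by simp
    ultimately have "\<psi> x = psi_seq \<alpha> \<epsilon> i x" by (rule LIMSEQ_unique[THEN sym])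
    also have "\<dots> = s * L - c * (x - L)" using t x by (auto simp: initial_tooth_def)
    finally show ?thesis .
  qed
  \<comment> \<open>Between \<open>L\<close> and \<open>R\<close> a point lies on the descent,
    before the zero \<open>L + s * L / c\<close> of the descending line, in the first affine piece
    and in the domain.\<close>
  define R where "R = min (min (L + \<delta>) (L + s * L / c)) (min (r 1) 1)"
  have "L < R" using L0 L1 c by (simp add: R_def)
  then obtain y where y: "L < y" "y < R" using dense by blast
  obtain x where x: "L < x" "x < y" using y(1) dense by blast
  have "y - L < s * L / c" using y(2) by (simp add: R_def)
  hence "\<psi> y > 0" using psi[of y] y c by (simp add: R_def field_simps)
  \<comment> \<open>Here \<open>\<psi> y = a 1 * y\<close> is positive with \<open>y > 0\<close>, so
    the first piece increases, against the descent from \<open>x\<close> to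
    \<open>y\<close>.\<close>
  hence "a 1 > 0" using lin[of y] b1 y L0 by (simp add: R_def zero_less_mult_iff)
  hence "a 1 * x < a 1 * y" using x by simp
  hence "\<psi> x < \<psi> y" using lin[of x] lin[of y] x y L0 b1 by (simp add: R_def)
  moreover have "\<psi> y < \<psi> x" using psi[of x] psi[of y] x y c by (simp add: R_def)
  ultimately show False by simp
qed

end
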